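(* Let $\omega_0\in[0,\pi]$, let $m>1$ be an integer, let $\mathbf{a}_0\in\ell_2^{2\times1}(\mathbb{Z})$, and let $$s(x)=\sum_{n\in\mathbb{Z}}\mathbf{a}_0^T[n]\,\boldsymbol\phi_{\omega_0}(x-n),$$ where $\boldsymbol\phi_{\omega_0}=(\phi_{1,\omega_0},\phi_{2,\omega_0})^T$ is the pair of generators defined in the context. Put $h_j=m^{-j}$ and, for $j\ge0$ and $n\in\mathbb{Z}$, $$\mathbf{H}_j[n]=\begin{bmatrix}\phi_{1,h_j\omega_0}(\frac nm)&h_j\,\phi_{2,h_j\omega_0}(\frac nm)\\ \frac1{h_j}(\phi_{1,h_j\omega_0})'(\frac nm)&(\phi_{2,h_j\omega_0})'(\frac nm)\end{bmatrix}.$$ Define recursively $$\mathbf{a}_{j+1}[n]=\sum_{\ell\in\mathbb{Z}}\mathbf{H}_j[n-m\ell]\,\mathbf{a}_j[\ell],\qquad n\in\mathbb{Z},\ j\ge0.$$ Then for every $J\ge0$ and $n\in\mathbb{Z}$, $\mathbf{a}_J^T[n]=\big(s(n/m^J),\,s'(n/m^J)\big)$. Moreover, when $m=2$, the masks $\mathbf{H}_j[n]$ vanish for $n\notin\{-1,0,1\}$, $\mathbf{H}_j[0]$ is the $2\times2$ identity matrix, and, with $\theta_j=\omega_0/2^j$ and $\sigma(\theta)=2\sin(\theta/2)-\theta\cos(\theta/2)$, $$\mathbf{H}_j[\pm1]=\begin{bmatrix}\frac12&\pm\frac{\tan(\theta_j/4)}{2\theta_j}h_j\\[4pt] \mp\frac{2\theta_j\sin^2(\theta_j/4)}{\sigma(\theta_j)}\cdot\frac1{h_j}&\frac{2\sin(\theta_j/2)-\theta_j}{2\sigma(\theta_j)}\end{bmatrix}$$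 (for $\omega_0=0$ the entries are understood as limits as $\theta_j\to0$, with $h_j$ fixed).
   Context: $\ell_2^{2\times1}(\mathbb{Z})$ is the space of square-summable sequences of $2\times1$ vectors. For $\omega_0\in(0,\pi]$ put $$\sigma(\omega_0)=2\sin(\omega_0/2)-\omega_0\cos(\omega_0/2),\qquad t(\omega_0)=2\sin(\omega_0/2)+\omega_0\cos(\omega_0/2),$$ $$u(\omega_0)=\omega_0\sin(\omega_0)-2(1-\cos(\omega_0)),\qquad v(\omega_0)=2\sin(\omega_0)+\omega_0(1-\cos(\omega_0)),$$ and let $\chi_{[0,1]}$ be the indicator function of $[0,1]$. Define $$g_{1,\omega_0}(x)=\Big(1-\tfrac{\sin(\omega_0/2)}{\sigma(\omega_0)}+\tfrac{\omega_0\cos(\omega_0/2)}{\sigma(\omega_0)}x+\tfrac{\sin(\omega_0/2-\omega_0x)}{\sigma(\omega_0)}\Big)\chi_{[0,1]}(x),$$ $$g_{2,\omega_0}(x)=\Big(\tfrac{\sin(\omega_0)-\omega_0\cos(\omega_0)}{\omega_0u(\omega_0)}+\tfrac{\sin(\omega_0/2)}{\sigma(\omega_0)}x-\tfrac{\omega_0^2\cos(\omega_0/2)\cos(\omega_0(1-x))+\sin(\omega_0/2)\big(\sin(\omega_0x)u(\omega_0)-\cos(\omega_0x)v(\omega_0)\big)}{2\omega_0\sin(\omega_0/2)\sigma(\omega_0)t(\omega_0)}\Big)\chi_{[0,1]}(x).$$ The generators are $\phi_{1,\omega_0}(x)=g_{1,\omega_0}(x)$ for $x\ge0$, $\phi_{1,\omega_0}(x)=g_{1,\omega_0}(-x)$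 for $x<0$; and $\phi_{2,\omega_0}(x)=g_{2,\omega_0}(x)$ for $x\ge0$, $\phi_{2,\omega_0}(x)=-g_{2,\omega_0}(-x)$ for $x<0$. They are continuously differentiable on $\mathbb{R}$. On $[0,1]$, $\phi_{1,\omega_0}$ and $\phi_{2,\omega_0}$ are the elements of $\mathrm{span}\{1,x,e^{i\omega_0x},e^{-i\omega_0x}\}$ with $\phi_1(0)=1,\phi_1'(0)=\phi_1(1)=\phi_1'(1)=0$ and $\phi_2'(0)=1,\phi_2(0)=\phi_2(1)=\phi_2'(1)=0$, respectively. For $\omega_0=0$ the functions are understood as the limits as $\omega_0\to0$: $g_{1,0}(x)=(2x+1)(x-1)^2\chi_{[0,1]}(x)$ and $g_{2,0}(x)=x(x-1)^2\chi_{[0,1]}(x)$, with the same symmetric and antisymmetric extensions. *)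

theory Defs
  imports "HOL-Analysis.Analysis"
begin

definition sigma_coeff :: "real \<Rightarrow> real" where
  "sigma_coeff \<omega> = 2 * sin (\<omega> / 2) - \<omega> * cos (\<omega> / 2)"

definition t_coeff :: "real \<Rightarrow> real" where
  "t_coeff \<omega> = 2 * sin (\<omega> / 2) + \<omega> * cos (\<omega> / 2)"

definition u_coeff :: "real \<Rightarrow> real" where
  "u_coeff \<omega> = \<omega> * sin \<omega> - 2 * (1 - cos \<omega>)"

definition v_coeff :: "real \<Rightarrow> real" where
  "v_coeff \<omega> = 2 * sin \<omega> + \<omega> * (1 - cos \<omega>)"

text \<open>For \<open>\<omega> = 0\<close> the trigonometric expressions below are undefined; their limits for
  \<open>\<omega> \<rightarrow> 0\<close> are the cubic Hermite polynomials.\<close>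

definition g1 :: "real \<Rightarrow> real \<Rightarrow> real" where
  "g1 \<omega> x =
    (if \<omega> = 0 then (2 * x + 1) * (x - 1)\<^sup>2
     else 1 - sin (\<omega> / 2) / sigma_coeff \<omega>
          + \<omega> * cos (\<omega> / 2) / sigma_coeff \<omega> * x
          + sin (\<omega> / 2 - \<omega> * x) / sigma_coeff \<omega>)
    * indicator {0..1} x"

definition g2 :: "real \<Rightarrow> real \<Rightarrow> real" where
  "g2 \<omega> x =
    (if \<omega> = 0 then x * (x - 1)\<^sup>2
     else (sin \<omega> - \<omega> * cos \<omega>) / (\<omega> * u_coeff \<omega>)
          + sin (\<omega> / 2) / sigma_coeff \<omega> * x
          - (\<omega>\<^sup>2 * cos (\<omega> / 2) * cos (\<omega> * (1 - x))
               + sin (\<omega> / 2) * (sin (\<omega> * x) * u_coeff \<omega> - cos (\<omega> * x) * v_coeff \<omega>))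
            / (2 * \<omega> * sin (\<omega> / 2) * sigma_coeff \<omega> * t_coeff \<omega>))
    * indicator {0..1} x"

definition phi1 :: "real \<Rightarrow> real \<Rightarrow> real" where
  "phi1 \<omega> x = (if x \<ge> 0 then g1 \<omega> x else g1 \<omega> (- x))"

definition phi2 :: "real \<Rightarrow> real \<Rightarrow> real" where
  "phi2 \<omega> x = (if x \<ge> 0 then g2 \<omega> x else - g2 \<omega> (- x))"

definition step_size :: "int \<Rightarrow> nat \<Rightarrow> real" where
  "step_size m j = 1 / of_int m ^ j"

definition hermite_mask :: "real \<Rightarrow> int \<Rightarrow> nat \<Rightarrow> int \<Rightarrow> real ^ 2 ^ 2" where
  "hermite_mask \<omega> m j n =
    (let h = step_size m j; x = of_int n / of_int m in
     vector
      [vector [phi1 (h * \<omega>) x, h * phi2 (h * \<omega>) x],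
       vector [1 / h * deriv (phi1 (h * \<omega>)) x, deriv (phi2 (h * \<omega>)) x]])"

text \<open>The closed form of the two nontrivial dyadic masks; \<open>\<epsilon> = 1\<close> or \<open>\<epsilon> = -1\<close> is the sign, and
  the formula is meaningful only for \<open>\<theta> \<noteq> 0\<close>.\<close>

definition dyadic_mask :: "real \<Rightarrow> real \<Rightarrow> real \<Rightarrow> real ^ 2 ^ 2" where
  "dyadic_mask \<theta> h \<epsilon> =
    vector
      [vector [1 / 2, \<epsilon> * (tan (\<theta> / 4) / (2 * \<theta>) * h)],
       vector [- \<epsilon> * (2 * \<theta> * (sin (\<theta> / 4))\<^sup>2 / sigma_coeff \<theta> * (1 / h)),
               (2 * sin (\<theta> / 2) - \<theta>) / (2 * sigma_coeff \<theta>)]]"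

end

theory Submission
  imports Defs "HOL-Real_Asymp.Real_Asymp"
begin

text \<open>Write \<open>V \<theta>\<close> for the span of \<open>1, x, cos (\<theta> x), sin (\<theta> x)\<close>, read as the cubic
  polynomials if \<open>\<theta> = 0\<close>. The two generators with parameter \<open>\<theta>\<close> are the cardinal functions of
  Hermite interpolation at the integers by \<open>C\<^sup>1\<close> splines whose pieces on the intervals
  \<open>[p, p + 1]\<close> lie in \<open>V \<theta>\<close>. Three facts about \<open>V \<theta>\<close> make the refinement work.

  \<^item> Hermite data at \<open>0\<close> and \<open>1\<close> determine an element of \<open>V \<theta>\<close> when \<open>0 \<le> \<theta> \<le> pi\<close>
    (\<open>exp_space_unisolvent\<close>): for \<open>\<theta> > 0\<close> the determinant of the linear system is a multiple of
    \<open>u_coeff \<theta> = - 2 sin (\<theta> / 2) \<sigma>(\<theta>)\<close>, and \<open>\<sigma>\<close> vanishes at \<open>0\<close> and is increasing.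
    Hence every element of \<open>V \<theta>\<close> is its own Hermite interpolant (\<open>hermite_interpolation\<close>).
  \<^item> An affine substitution with factor \<open>1 / m\<close> maps \<open>V \<theta>\<close> to \<open>V (\<theta> / m)\<close>
    (\<open>exp_space_affine\<close>).
  \<^item> A grid cell of width \<open>1 / m\<close> lies inside one interval \<open>[p, p + 1]\<close>.

  Together these say that an exponential spline with parameter \<open>\<theta>\<close> on the integer grid, sampled
  with its derivative on the grid of width \<open>1 / m\<close>, is recovered exactly by the generators with
  parameter \<open>\<theta> / m\<close> on the finer grid (\<open>exp_spline_refine\<close>, \<open>hermite_spline_refine\<close>). The
  subdivision rule computes precisely these samples (\<open>mask_sum_component\<close>), so by induction on
  the level \<open>j\<close> one and the same function \<open>s\<close> is the Hermite spline with data \<open>a j\<close> on the grid of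
  width \<open>h = m ^ (- j)\<close> (\<open>subdivision_spline\<close>). Reading off value and derivative of \<open>s\<close> at the
  grid points gives the first claim. All sums over the integers are locally finite, because the
  generators and their derivatives vanish outside the open interval \<open>(-1, 1)\<close>.

  The closed form of the dyadic masks amounts to evaluating the generators at \<open>1 / 2\<close>
  (\<open>shapes_at_half\<close>); for parameter \<open>0\<close> it remains to take the limit of the entries.\<close>

section \<open>Exponential polynomials\<close>

definition quad_or_cos :: "real \<Rightarrow> real \<Rightarrow> real" where
  "quad_or_cos \<theta> x = (if \<theta> = 0 then x\<^sup>2 else cos (\<theta> * x))"

definition cube_or_sin :: "real \<Rightarrow> real \<Rightarrow> real" where
  "cube_or_sin \<theta> x = (if \<theta> = 0 then x ^ 3 else sin (\<theta> * x))"

text \<open>The space is a predicate on pairs of a function and its derivative, so that Hermite data need no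
  recourse to \<open>deriv\<close>. With the cubics standing in at \<open>\<theta> = 0\<close>, it is the
  kernel of \<open>D ^ 4 + \<theta>\<^sup>2 D\<^sup>2\<close> for every \<open>\<theta>\<close>.\<close>

definition exp_space :: "real \<Rightarrow> (real \<Rightarrow> real) \<Rightarrow> (real \<Rightarrow> real) \<Rightarrow> bool" where
  "exp_space \<theta> f f' \<longleftrightarrow> (\<exists>A B C D. \<forall>x.
     f x = A + B * x + C * quad_or_cos \<theta> x + D * cube_or_sin \<theta> x \<and>
     f' x = B + C * (if \<theta> = 0 then 2 * x else - \<theta> * sin (\<theta> * x))
              + D * (if \<theta> = 0 then 3 * x\<^sup>2 else \<theta> * cos (\<theta> * x)))"

lemma exp_spaceI:
  assumes "\<And>x. f x = A + B * x + C * quad_or_cos \<theta> x + D * cube_or_sin \<theta> x"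
    and "\<And>x. f' x = B + C * (if \<theta> = 0 then 2 * x else - \<theta> * sin (\<theta> * x))
                      + D * (if \<theta> = 0 then 3 * x\<^sup>2 else \<theta> * cos (\<theta> * x))"
  shows "exp_space \<theta> f f'"
  unfolding exp_space_def using assms by blast

lemma exp_space_has_derivative:
  assumes "exp_space \<theta> f f'"
  shows "(f has_real_derivative f' x) (at x)"
proof -
  obtain A B C D where f: "\<And>x. f x = A + B * x + C * quad_or_cos \<theta> x + D * cube_or_sin \<theta> x"
    and f': "f' x = B + C * (if \<theta> = 0 then 2 * x else - \<theta> * sin (\<theta> * x))
              + D * (if \<theta> = 0 then 3 * x\<^sup>2 else \<theta> * cos (\<theta> * x))"
    using assms unfolding exp_space_def by blast
  have "f = (\<lambda>x. A + B * x + C * quad_or_cos \<theta> x + D * cube_or_sin \<theta> x)"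
    using f by blast
  then show ?thesis
    unfolding f' quad_or_cos_def cube_or_sin_def
    by (cases "\<theta> = 0") (auto intro!: derivative_eq_intros)
qed

lemma exp_space_lincomb:
  assumes "exp_space \<theta> f f'" "exp_space \<theta> g g'"
  shows "exp_space \<theta> (\<lambda>x. p * f x + q * g x) (\<lambda>x. p * f' x + q * g' x)"
proof -
  obtain A B C D where f: "\<And>x. f x = A + B * x + C * quad_or_cos \<theta> x + D * cube_or_sin \<theta> x"
    and f': "\<And>x. f' x = B + C * (if \<theta> = 0 then 2 * x else - \<theta> * sin (\<theta> * x))
              + D * (if \<theta> = 0 then 3 * x\<^sup>2 else \<theta> * cos (\<theta> * x))"
    using assms(1) unfolding exp_space_def by blast
  obtain A' B' C' D' where g: "\<And>x. g x = A' + B' * x + C' * quad_or_cos \<theta> x + D' * cube_or_sin \<theta> x"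
    and g': "\<And>x. g' x = B' + C' * (if \<theta> = 0 then 2 * x else - \<theta> * sin (\<theta> * x))
              + D' * (if \<theta> = 0 then 3 * x\<^sup>2 else \<theta> * cos (\<theta> * x))"
    using assms(2) unfolding exp_space_def by blast
  show ?thesis
    by (rule exp_spaceI[where A = "p * A + q * A'" and B = "p * B + q * B'"
          and C = "p * C + q * C'" and D = "p * D + q * D'"])
       (simp_all only: f f' g g' distrib_left distrib_right mult.assoc add_ac)
qed

text \<open>By the addition theorems, a shift acts within the space and only a dilation changes the frequency.
  This is what replaces \<open>\<theta>\<close> by \<open>\<theta> / m\<close> when the grid is refined.\<close>

lemma exp_space_affine:
  assumes "exp_space \<theta> f f'" and "\<alpha> \<noteq> 0"
  shows "exp_space (\<alpha> * \<theta>) (\<lambda>x. f (\<alpha> * x + \<beta>)) (\<lambda>x. \<alpha> * f' (\<alpha> * x + \<beta>))"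
proof -
  obtain A B C D where f: "\<And>x. f x = A + B * x + C * quad_or_cos \<theta> x + D * cube_or_sin \<theta> x"
    and f': "\<And>x. f' x = B + C * (if \<theta> = 0 then 2 * x else - \<theta> * sin (\<theta> * x))
              + D * (if \<theta> = 0 then 3 * x\<^sup>2 else \<theta> * cos (\<theta> * x))"
    using assms(1) unfolding exp_space_def by blast
  show ?thesis
  proof (cases "\<theta> = 0")
    case True
    show ?thesis
      by (rule exp_spaceI[where A = "A + B * \<beta> + C * \<beta>\<^sup>2 + D * \<beta> ^ 3"
            and B = "B * \<alpha> + 2 * C * \<alpha> * \<beta> + 3 * D * \<alpha> * \<beta>\<^sup>2"
            and C = "C * \<alpha>\<^sup>2 + 3 * D * \<alpha>\<^sup>2 * \<beta>" and D = "D * \<alpha> ^ 3"])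
         (simp_all add: f f' True quad_or_cos_def cube_or_sin_def algebra_simps
           power2_eq_square power3_eq_cube)
  next
    case False
    have 1: "\<theta> * (\<alpha> * x + \<beta>) = \<alpha> * \<theta> * x + \<theta> * \<beta>" for x
      by (simp add: algebra_simps)
    show ?thesis
      by (rule exp_spaceI[where A = "A + B * \<beta>" and B = "B * \<alpha>"
            and C = "C * cos (\<theta> * \<beta>) + D * sin (\<theta> * \<beta>)"
            and D = "D * cos (\<theta> * \<beta>) - C * sin (\<theta> * \<beta>)"])
         (use False assms(2) in \<open>simp_all add: f f' quad_or_cos_def cube_or_sin_def 1 cos_add sin_add,
           simp_all add: algebra_simps\<close>)
  qed
qed

lemma exp_space_minus:
  assumes "exp_space (- \<theta>) f f'"
  shows "exp_space \<theta> f f'"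
proof -
  obtain A B C D where
    f: "\<And>x. f x = A + B * x + C * quad_or_cos (- \<theta>) x + D * cube_or_sin (- \<theta>) x" and
    f': "\<And>x. f' x = B + C * (if - \<theta> = 0 then 2 * x else - (- \<theta>) * sin (- \<theta> * x))
              + D * (if - \<theta> = 0 then 3 * x\<^sup>2 else - \<theta> * cos (- \<theta> * x))"
    using assms unfolding exp_space_def by blast
  show ?thesis
    by (rule exp_spaceI[where A = A and B = B and C = C and D = "if \<theta> = 0 then D else - D"])
       (simp_all add: f f' quad_or_cos_def cube_or_sin_def)
qed

lemma exp_space_reflect:
  assumes "exp_space \<theta> f f'"
  shows "exp_space \<theta> (\<lambda>x. f (\<beta> - x)) (\<lambda>x. - f' (\<beta> - x))"
  using exp_space_minus[of \<theta>] exp_space_affine[OF assms, of "-1" \<beta>] by simp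

text \<open>The derivative of \<open>\<sigma>\<close> is \<open>x sin (x / 2) / 2\<close>, which is positive on the open interval, and
  \<open>\<sigma> 0 = 0\<close>.\<close>

lemma sigma_coeff_pos:
  assumes "0 < \<theta>" "\<theta> \<le> pi"
  shows "sigma_coeff \<theta> > 0"
proof -
  have "sigma_coeff 0 < sigma_coeff \<theta>"
  proof (rule DERIV_pos_imp_increasing_open[OF assms(1)])
    fix x assume x: "0 < x" "x < \<theta>"
    have "(sigma_coeff has_real_derivative x * sin (x / 2) / 2) (at x)"
      unfolding sigma_coeff_def[abs_def]
      by (auto intro!: derivative_eq_intros)
    moreover have "sin (x / 2) > 0"
      using x assms by (intro sin_gt_zero) auto
    ultimately show "\<exists>y. (sigma_coeff has_real_derivative y) (at x) \<and> y > 0"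
      using x by (intro exI[of _ "x * sin (x / 2) / 2"]) auto
  next
    show "continuous_on {0..\<theta>} sigma_coeff"
      unfolding sigma_coeff_def[abs_def] by (intro continuous_intros)  auto
  qed
  then show ?thesis by (simp add: sigma_coeff_def)
qed

lemma t_coeff_pos:
  assumes "0 < \<theta>" "\<theta> \<le> pi"
  shows "t_coeff \<theta> > 0"
proof -
  have "sin (\<theta> / 2) > 0"
    using assms by (intro sin_gt_zero) auto
  moreover have "cos (\<theta> / 2) \<ge> 0"
    using assms by (intro cos_ge_zero) auto
  ultimately show ?thesis
    using assms by (auto simp: t_coeff_def intro!: add_pos_nonneg mult_nonneg_nonneg)
qed

lemma sin_double_half: "sin (\<theta>::real) = 2 * sin (\<theta> / 2) * cos (\<theta> / 2)"
  using sin_double[of "\<theta> / 2"] by simp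

lemma cos_double_half: "cos (\<theta>::real) = (cos (\<theta> / 2))\<^sup>2 - (sin (\<theta> / 2))\<^sup>2"
  using cos_double[of "\<theta> / 2"] by simp

text \<open>These two factorisations express the coefficients of the generators by half-angles, after which
  identities between them become polynomial identities in \<open>sin (\<theta> / 2)\<close> and \<open>cos (\<theta> / 2)\<close>.\<close>

lemma u_coeff_factor: "u_coeff \<theta> = - 2 * sin (\<theta> / 2) * sigma_coeff \<theta>"
  unfolding u_coeff_def sigma_coeff_def sin_double_half[of \<theta>] cos_double_half[of \<theta>]
  using sin_cos_squared_add[of "\<theta> / 2"] by algebra

lemma v_coeff_factor: "v_coeff \<theta> = 2 * sin (\<theta> / 2) * (2 * cos (\<theta> / 2) + \<theta> * sin (\<theta> / 2))"
  unfolding v_coeff_def sin_double_half[of \<theta>] cos_double_half[of \<theta>]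
  using sin_cos_squared_add[of "\<theta> / 2"] by algebra

text \<open>The data at \<open>0\<close> eliminate the two polynomial coefficients; the data at \<open>1\<close> leave a
  \<open>2 \<times> 2\<close> system for the trigonometric ones, whose determinant is \<open>- u_coeff \<theta>\<close>.\<close>

lemma exp_space_unisolvent:
  assumes "exp_space \<theta> f f'" and "0 \<le> \<theta>" "\<theta> \<le> pi"
    and "f 0 = 0" "f' 0 = 0" "f 1 = 0" "f' 1 = 0"
  shows "f x = 0"
proof -
  obtain A B C D where f: "\<And>x. f x = A + B * x + C * quad_or_cos \<theta> x + D * cube_or_sin \<theta> x"
    and f': "\<And>x. f' x = B + C * (if \<theta> = 0 then 2 * x else - \<theta> * sin (\<theta> * x))
              + D * (if \<theta> = 0 then 3 * x\<^sup>2 else \<theta> * cos (\<theta> * x))"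
    using assms(1) unfolding exp_space_def by blast
  show ?thesis
  proof (cases "\<theta> = 0")
    case True
    then have "A = 0" "B = 0" "A + B + C + D = 0" "B + 2 * C + 3 * D = 0"
      using assms(4-7) by (simp_all add: f f' quad_or_cos_def cube_or_sin_def)
    then have "A = 0 \<and> B = 0 \<and> C = 0 \<and> D = 0" by linarith
    then show ?thesis by (simp add: f)
  next
    case False
    then have pos: "0 < \<theta>" using assms by simp
    have A: "A = - C" and B: "B = - \<theta> * D"
      and e1: "A + B + C * cos \<theta> + D * sin \<theta> = 0"
      and e2: "B - C * \<theta> * sin \<theta> + D * \<theta> * cos \<theta> = 0"
      using False assms(4-7) by (simp_all add: f f' quad_or_cos_def cube_or_sin_def algebra_simps)
    have e2': "D * (cos \<theta> - 1) = C * sin \<theta>"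
      using e2 False unfolding B by (simp add: field_simps) algebra
    have e1': "C * (cos \<theta> - 1) = D * (\<theta> - sin \<theta>)"
      using e1 unfolding A B by (simp add: algebra_simps)
    have "C * u_coeff \<theta> = 0" "D * u_coeff \<theta> = 0"
      unfolding u_coeff_def using e1' e2' sin_cos_squared_add[of \<theta>] by algebra+
    moreover have "u_coeff \<theta> \<noteq> 0"
    proof -
      have "sin (\<theta> / 2) > 0" using pos assms by (intro sin_gt_zero) auto
      then show ?thesis
        using sigma_coeff_pos[OF pos assms(3)] by (simp add: u_coeff_factor)
    qed
    ultimately have "C = 0" "D = 0" by auto
    then show ?thesis using A B by (simp add: f)
  qed
qed

section \<open>Hermite interpolation on the unit interval\<close>

text \<open>The generators restricted to \<open>[0, 1]\<close>, continued to the whole line by the same expression. The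
  second one is simplified from the formula in \<open>g2_def\<close>, see \<open>g2_eq\<close>.\<close>

definition value_shape :: "real \<Rightarrow> real \<Rightarrow> real" where
  "value_shape \<theta> x = (if \<theta> = 0 then (2 * x + 1) * (x - 1)\<^sup>2
     else 1 - sin (\<theta> / 2) / sigma_coeff \<theta>
          + \<theta> * cos (\<theta> / 2) / sigma_coeff \<theta> * x
          + sin (\<theta> / 2 - \<theta> * x) / sigma_coeff \<theta>)"

definition value_shape' :: "real \<Rightarrow> real \<Rightarrow> real" where
  "value_shape' \<theta> x = (if \<theta> = 0 then 6 * x * (x - 1)
     else (\<theta> * cos (\<theta> / 2) - \<theta> * cos (\<theta> / 2 - \<theta> * x)) / sigma_coeff \<theta>)"

definition slope_shape :: "real \<Rightarrow> real \<Rightarrow> real" where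
  "slope_shape \<theta> x = (if \<theta> = 0 then x * (x - 1)\<^sup>2
     else ((\<theta> * cos \<theta> - sin \<theta>) * (1 - cos (\<theta> * x)) / (2 * sin (\<theta> / 2))
           + \<theta> * sin (\<theta> / 2) * x
           + (sin (\<theta> / 2) - \<theta> * cos (\<theta> / 2)) * sin (\<theta> * x)) / (\<theta> * sigma_coeff \<theta>))"

definition slope_shape' :: "real \<Rightarrow> real \<Rightarrow> real" where
  "slope_shape' \<theta> x = (if \<theta> = 0 then (x - 1) * (3 * x - 1)
     else ((\<theta> * cos \<theta> - sin \<theta>) * sin (\<theta> * x) / (2 * sin (\<theta> / 2))
           + sin (\<theta> / 2)
           + (sin (\<theta> / 2) - \<theta> * cos (\<theta> / 2)) * cos (\<theta> * x)) / sigma_coeff \<theta>)"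

lemma exp_space_value_shape: 
  assumes "0 \<le> \<theta>" "\<theta> \<le> pi"
  shows "exp_space \<theta> (value_shape \<theta>) (value_shape' \<theta>)"
proof (cases "\<theta> = 0")
  case True
  show ?thesis
    by (rule exp_spaceI[where A = 1 and B = 0 and C = "-3" and D = 2])
      (simp_all add: True value_shape_def value_shape'_def quad_or_cos_def cube_or_sin_def power2_eq_square
         power3_eq_cube algebra_simps)
next
  case False
  then have "sigma_coeff \<theta> \<noteq> 0" using sigma_coeff_pos[of \<theta>] assms by auto
  then show ?thesis
    by (intro exp_spaceI[where A = "1 - sin (\<theta> / 2) / sigma_coeff \<theta>"
          and B = "\<theta> * cos (\<theta> / 2) / sigma_coeff \<theta>"
          and C = "sin (\<theta> / 2) / sigma_coeff \<theta>" and D = "- cos (\<theta> / 2) / sigma_coeff \<theta>"])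
      (simp_all add: False value_shape_def value_shape'_def quad_or_cos_def cube_or_sin_def sin_diff cos_diff
         diff_divide_distrib add_divide_distrib algebra_simps)
qed

lemma exp_space_slope_shape: 
  assumes "0 \<le> \<theta>" "\<theta> \<le> pi"
  shows "exp_space \<theta> (slope_shape \<theta>) (slope_shape' \<theta>)"
proof (cases "\<theta> = 0")
  case True
  show ?thesis
    by (rule exp_spaceI[where A = 0 and B = 1 and C = "-2" and D = 1])
      (simp_all add: True slope_shape_def slope_shape'_def quad_or_cos_def cube_or_sin_def power2_eq_square
         power3_eq_cube algebra_simps)
next
  case False
  then have "sigma_coeff \<theta> \<noteq> 0" "sin (\<theta> / 2) \<noteq> 0"
    using sigma_coeff_pos[of \<theta>] sin_gt_zero[of "\<theta> / 2"] assms by auto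
  then show ?thesis
    by (intro exp_spaceI[where A = "(\<theta> * cos \<theta> - sin \<theta>) / (2 * sin (\<theta> / 2)) / (\<theta> * sigma_coeff \<theta>)"
          and B = "sin (\<theta> / 2) / sigma_coeff \<theta>"
          and C = "- (\<theta> * cos \<theta> - sin \<theta>) / (2 * sin (\<theta> / 2)) / (\<theta> * sigma_coeff \<theta>)" 
          and D = "(sin (\<theta> / 2) - \<theta> * cos (\<theta> / 2)) / (\<theta> * sigma_coeff \<theta>)"])
      (simp_all add: False slope_shape_def slope_shape'_def quad_or_cos_def cube_or_sin_def field_simps)
qed

lemma value_shape_endpoints:
  assumes "0 \<le> \<theta>" "\<theta> \<le> pi"
  shows "value_shape \<theta> 0 = 1" "value_shape' \<theta> 0 = 0" "value_shape \<theta> 1 = 0" "value_shape' \<theta> 1 = 0"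
proof -
  have *: "sigma_coeff \<theta> \<noteq> 0" if "\<theta> \<noteq> 0" using sigma_coeff_pos[of \<theta>] assms that by auto
  have "\<theta> / 2 - \<theta> = - (\<theta> / 2)" by simp
  then have **: "sin (\<theta> / 2 - \<theta>) = - sin (\<theta> / 2)" "cos (\<theta> / 2 - \<theta>) = cos (\<theta> / 2)"
    by (simp_all only: sin_minus cos_minus)
  show "value_shape \<theta> 0 = 1" "value_shape' \<theta> 0 = 0" "value_shape' \<theta> 1 = 0"
    by (simp_all add: value_shape_def value_shape'_def **)
  show "value_shape \<theta> 1 = 0"
    using * by (simp add: value_shape_def ** divide_simps) (simp add: sigma_coeff_def)
qed

lemma slope_shape_endpoints:
  assumes "0 \<le> \<theta>" "\<theta> \<le> pi"
  shows "slope_shape \<theta> 0 = 0" "slope_shape' \<theta> 0 = 1" "slope_shape \<theta> 1 = 0" "slope_shape' \<theta> 1 = 0"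
proof -
  have *: "sigma_coeff \<theta> \<noteq> 0" "sin (\<theta> / 2) \<noteq> 0" if "\<theta> \<noteq> 0"
    using sigma_coeff_pos[of \<theta>] sin_gt_zero[of "\<theta> / 2"] assms that by auto
  show "slope_shape \<theta> 0 = 0" by (simp add: slope_shape_def)
  show "slope_shape' \<theta> 0 = 1"
    using * by (auto simp: slope_shape'_def) (simp add: sigma_coeff_def)
  show "slope_shape \<theta> 1 = 0" "slope_shape' \<theta> 1 = 0" 
    using * apply (auto simp: slope_shape_def slope_shape'_def field_simps)
    unfolding sin_double_half[of \<theta>] cos_double_half[of \<theta>]
    using sin_cos_squared_add[of "\<theta> / 2"] by algebra+
qed

text \<open>Both sides have the same Hermite data at \<open>0\<close> and \<open>1\<close>, so unisolvence applies to their
  difference. The last sign arises because reflecting \<open>x\<close> to \<open>1 - x\<close> negates derivatives.\<close>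

lemma hermite_interpolation:
  assumes "exp_space \<theta> f f'" and \<theta>: "0 \<le> \<theta>" "\<theta> \<le> pi"
  shows "f x = f 0 * value_shape \<theta> x + f' 0 * slope_shape \<theta> x + f 1 * value_shape \<theta> (1 - x) - f' 1 * slope_shape \<theta> (1 - x)"
proof -
  note W = exp_space_value_shape[OF \<theta>] exp_space_slope_shape[OF \<theta>]
  note V = value_shape_endpoints[OF \<theta>] slope_shape_endpoints[OF \<theta>]
  define d d' where "d = (\<lambda>x. f 0 * value_shape \<theta> x + f' 0 * slope_shape \<theta> x)"
    and "d' = (\<lambda>x. f 0 * value_shape' \<theta> x + f' 0 * slope_shape' \<theta> x)"
  define e e' where "e = (\<lambda>x. f 1 * value_shape \<theta> (1 - x) + (- f' 1) * slope_shape \<theta> (1 - x))"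
    and "e' = (\<lambda>x. f 1 * (- value_shape' \<theta> (1 - x)) + (- f' 1) * (- slope_shape' \<theta> (1 - x)))"
  have "exp_space \<theta> d d'" "exp_space \<theta> e e'"
    unfolding d_def d'_def e_def e'_def
    by (rule exp_space_lincomb W exp_space_reflect)+
  then have "exp_space \<theta> (\<lambda>x. 1 * f x + (-1) * (1 * d x + 1 * e x))
                          (\<lambda>x. 1 * f' x + (-1) * (1 * d' x + 1 * e' x))"
    by (intro exp_space_lincomb assms(1))
  from exp_space_unisolvent[OF this \<theta>] have "f x - (d x + e x) = 0"
    by (simp add: d_def d'_def e_def e'_def V algebra_simps)
  then show ?thesis by (simp add: d_def e_def)
qed

section \<open>The generators are continuously differentiable exponential splines\<close>

lemma g1_eq: "g1 \<theta> x = value_shape \<theta> x * indicator {0..1} x"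
  by (simp add: g1_def value_shape_def)

text \<open>After the half-angle substitution the common factor \<open>t_coeff \<theta>\<close> cancels.\<close>

lemma g2_eq:
  assumes "0 \<le> \<theta>" "\<theta> \<le> pi"
  shows "g2 \<theta> x = slope_shape \<theta> x * indicator {0..1} x"
proof (cases "\<theta> = 0")
  case True
  then show ?thesis by (simp add: g2_def slope_shape_def)
next
  case False
  define s c where "s = sin (\<theta> / 2)" and "c = cos (\<theta> / 2)"
  define p q where "p = sin (\<theta> * x)" and "q = cos (\<theta> * x)"
  have nz: "\<theta> \<noteq> 0" "sigma_coeff \<theta> \<noteq> 0" "s \<noteq> 0" "t_coeff \<theta> \<noteq> 0"
    using sigma_coeff_pos[of \<theta>] t_coeff_pos[of \<theta>] sin_gt_zero[of "\<theta> / 2"] assms False 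
    by (auto simp: s_def)
  have sc: "s\<^sup>2 + c\<^sup>2 = 1" by (simp add: s_def c_def)
  have d: "sin \<theta> = 2 * s * c" "cos \<theta> = c\<^sup>2 - s\<^sup>2"
    unfolding s_def c_def by (rule sin_double_half, rule cos_double_half)
  have st: "sigma_coeff \<theta> = 2 * s - \<theta> * c" "t_coeff \<theta> = 2 * s + \<theta> * c"
    by (simp_all add: sigma_coeff_def t_coeff_def s_def c_def)
  have q: "cos (\<theta> * (1 - x)) = (c\<^sup>2 - s\<^sup>2) * q + 2 * s * c * p"
    by (simp add: right_diff_distrib cos_diff d p_def q_def)
  have "(sin \<theta> - \<theta> * cos \<theta>) / (\<theta> * u_coeff \<theta>)
          + s / sigma_coeff \<theta> * x
          - (\<theta>\<^sup>2 * c * cos (\<theta> * (1 - x))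
               + s * (p * u_coeff \<theta> - q * v_coeff \<theta>))
            / (2 * \<theta> * s * sigma_coeff \<theta> * t_coeff \<theta>)
     = (- (2 * s * c - \<theta> * (c\<^sup>2 - s\<^sup>2)) * t_coeff \<theta> + 2 * \<theta> * s\<^sup>2 * t_coeff \<theta> * x 
          - (\<theta>\<^sup>2 * c * ((c\<^sup>2 - s\<^sup>2) * q + 2 * s * c * p)
               + s * (p * (- 2 * s * sigma_coeff \<theta>) - q * (2 * s * (2 * c + \<theta> * s)))))
            / (2 * \<theta> * s * sigma_coeff \<theta> * t_coeff \<theta>)"
    unfolding q d u_coeff_factor v_coeff_factor s_def[symmetric] c_def[symmetric]
    using nz by (simp add: divide_simps) algebra
  also have "- (2 * s * c - \<theta> * (c\<^sup>2 - s\<^sup>2)) * t_coeff \<theta> + 2 * \<theta> * s\<^sup>2 * t_coeff \<theta> * x 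
          - (\<theta>\<^sup>2 * c * ((c\<^sup>2 - s\<^sup>2) * q + 2 * s * c * p)
               + s * (p * (- 2 * s * sigma_coeff \<theta>) - q * (2 * s * (2 * c + \<theta> * s))))
      = ((\<theta> * (c\<^sup>2 - s\<^sup>2) - 2 * s * c) * (1 - q) + 2 * s * (\<theta> * s * x
           + (s - \<theta> * c) * p)) * t_coeff \<theta>"
    unfolding st by (simp add: algebra_simps power2_eq_square power3_eq_cube)
  also have "\<dots> / (2 * \<theta> * s * sigma_coeff \<theta> * t_coeff \<theta>) = slope_shape \<theta> x"
    unfolding slope_shape_def d s_def[symmetric] c_def[symmetric] p_def[symmetric] q_def[symmetric]
    using nz by (simp add: field_simps) 
  finally show ?thesis 
    unfolding g2_def s_def[symmetric] c_def[symmetric] p_def[symmetric] q_def[symmetric]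
    using False by simp
qed


lemma has_real_derivative_If_le:
  fixes f g f' g' :: "real \<Rightarrow> real"
  assumes f: "\<And>x. x \<le> a \<Longrightarrow> (f has_real_derivative f' x) (at x)"
    and g: "\<And>x. a \<le> x \<Longrightarrow> (g has_real_derivative g' x) (at x)"
    and eq: "f a = g a" "f' a = g' a"
  shows "((\<lambda>x. if x \<le> a then f x else g x) has_real_derivative (if x \<le> a then f' x else g' x)) (at x)"
proof -
  have "((\<lambda>x. if x \<in> {..a} then f x else g x) has_vector_derivative
          (if x \<in> {..a} then f' x else g' x)) (at x within UNIV)"
  proof (rule has_vector_derivative_If_within_closures)
    have cl: "closure {..a} = {..a}" "closure {a<..} = {a..}" by simp_all
    show "x \<in> {..a} \<union> {a<..}" "UNIV = {..a} \<union> {a<..}" by auto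
    show "(f has_vector_derivative f' x) (at x within {..a} \<union> closure {..a} \<inter> closure {a<..})"
      if "x \<in> {..a} \<union> closure {..a} \<inter> closure {a<..}"
      using f[of x] that
      by (auto simp: cl has_real_derivative_iff_has_vector_derivative
            intro: has_vector_derivative_at_within)
    show "(g has_vector_derivative g' x) (at x within {a<..} \<union> closure {..a} \<inter> closure {a<..})"
      if "x \<in> {a<..} \<union> closure {..a} \<inter> closure {a<..}"
      using g[of x] that
      by (auto simp: cl has_real_derivative_iff_has_vector_derivative
            intro: has_vector_derivative_at_within)
    show "f x = g x" "f' x = g' x" if "x \<in> closure {..a}" "x \<in> closure {a<..}"
      using that eq by (auto simp: cl)
  qed
  then show ?thesis
    by (simp add: has_real_derivative_iff_has_vector_derivative)
qed

definition dphi1 :: "real \<Rightarrow> real \<Rightarrow> real" where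
  "dphi1 \<theta> x = (if x \<le> -1 then 0 else if x \<le> 0 then - value_shape' \<theta> (- x)
     else if x \<le> 1 then value_shape' \<theta> x else 0)"

definition dphi2 :: "real \<Rightarrow> real \<Rightarrow> real" where
  "dphi2 \<theta> x = (if x \<le> -1 then 0 else if x \<le> 0 then slope_shape' \<theta> (- x)
     else if x \<le> 1 then slope_shape' \<theta> x else 0)"

lemma phi1_cases:
  assumes "0 \<le> \<theta>" "\<theta> \<le> pi"
  shows "phi1 \<theta> x = (if x \<le> -1 then 0 else if x \<le> 0 then value_shape \<theta> (- x)
           else if x \<le> 1 then value_shape \<theta> x else 0)"
  using value_shape_endpoints[OF assms]
  by (auto simp: phi1_def g1_eq indicator_def order_le_less)

lemma phi2_cases:
  assumes "0 \<le> \<theta>" "\<theta> \<le> pi"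
  shows "phi2 \<theta> x = (if x \<le> -1 then 0 else if x \<le> 0 then - slope_shape \<theta> (- x)
           else if x \<le> 1 then slope_shape \<theta> x else 0)"
  using slope_shape_endpoints[OF assms]
  by (auto simp: phi2_def g2_eq[OF assms] indicator_def order_le_less)

lemma phi1_has_derivative:
  assumes "0 \<le> \<theta>" "\<theta> \<le> pi"
  shows "(phi1 \<theta> has_real_derivative dphi1 \<theta> x) (at x)"
proof -
  note V = value_shape_endpoints[OF assms]
  note D = exp_space_has_derivative[OF exp_space_value_shape[OF assms]]
    exp_space_has_derivative[OF exp_space_reflect[OF exp_space_value_shape[OF assms], where \<beta> = 0], simplified]
  have "phi1 \<theta> = (\<lambda>x. if x \<le> -1 then 0 else if x \<le> 0 then value_shape \<theta> (- x)
           else if x \<le> 1 then value_shape \<theta> x else 0)"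
    using phi1_cases[OF assms] by blast
  then show ?thesis
    unfolding dphi1_def
    by (simp only:) (intro has_real_derivative_If_le D DERIV_const, simp_all add: V)
qed

lemma phi2_has_derivative:
  assumes "0 \<le> \<theta>" "\<theta> \<le> pi"
  shows "(phi2 \<theta> has_real_derivative dphi2 \<theta> x) (at x)"
proof -
  note V = slope_shape_endpoints[OF assms]
  note D = exp_space_has_derivative[OF exp_space_slope_shape[OF assms]]
    DERIV_minus[OF exp_space_has_derivative[OF exp_space_reflect[OF exp_space_slope_shape[OF assms], where \<beta> = 0]], simplified]
  have "phi2 \<theta> = (\<lambda>x. if x \<le> -1 then 0 else if x \<le> 0 then - slope_shape \<theta> (- x)
           else if x \<le> 1 then slope_shape \<theta> x else 0)"
    using phi2_cases[OF assms] by blast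
  then show ?thesis
    unfolding dphi2_def
    by (simp only:) (intro has_real_derivative_If_le D DERIV_const, simp_all add: V)
qed

lemma phi_outside:
  assumes "0 \<le> \<theta>" "\<theta> \<le> pi" "\<bar>x\<bar> \<ge> 1"
  shows "phi1 \<theta> x = 0" "phi2 \<theta> x = 0" "dphi1 \<theta> x = 0" "dphi2 \<theta> x = 0"
proof -
  have "x \<le> -1 \<or> x = 1 \<or> x > 1" using assms(3) by auto
  then show "phi1 \<theta> x = 0" "phi2 \<theta> x = 0" "dphi1 \<theta> x = 0" "dphi2 \<theta> x = 0"
    using value_shape_endpoints[OF assms(1,2)] slope_shape_endpoints[OF assms(1,2)]
    by (auto simp: phi1_cases phi2_cases dphi1_def dphi2_def assms(1,2))
qed

lemma phi_zero:
  assumes "0 \<le> \<theta>" "\<theta> \<le> pi"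
  shows "phi1 \<theta> 0 = 1" "phi2 \<theta> 0 = 0" "dphi1 \<theta> 0 = 0" "dphi2 \<theta> 0 = 1"
  using value_shape_endpoints[OF assms] slope_shape_endpoints[OF assms]
  by (auto simp: phi1_cases phi2_cases dphi1_def dphi2_def assms(1,2))

lemma phi_unit_interval:
  assumes "0 \<le> \<theta>" "\<theta> \<le> pi" "0 \<le> x" "x \<le> 1"
  shows "phi1 \<theta> x = value_shape \<theta> x" "phi2 \<theta> x = slope_shape \<theta> x"
    "dphi1 \<theta> x = value_shape' \<theta> x" "dphi2 \<theta> x = slope_shape' \<theta> x"
  using assms(3,4) value_shape_endpoints[OF assms(1,2)] slope_shape_endpoints[OF assms(1,2)]
  by (auto simp: phi1_cases phi2_cases dphi1_def dphi2_def assms(1,2))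

lemma phi_neg_unit_interval:
  assumes "0 \<le> \<theta>" "\<theta> \<le> pi" "-1 \<le> x" "x \<le> 0"
  shows "phi1 \<theta> x = value_shape \<theta> (- x)" "phi2 \<theta> x = - slope_shape \<theta> (- x)"
    "dphi1 \<theta> x = - value_shape' \<theta> (- x)" "dphi2 \<theta> x = slope_shape' \<theta> (- x)"
  using assms(3,4) value_shape_endpoints[OF assms(1,2)] slope_shape_endpoints[OF assms(1,2)]
  by (auto simp: phi1_cases phi2_cases dphi1_def dphi2_def assms(1,2))

text \<open>The cells are closed, so both adjacent pieces prescribe the value and the derivative at an
  integer; this encodes that the spline is \<open>C\<^sup>1\<close>.\<close>

definition exp_spline :: "real \<Rightarrow> (real \<Rightarrow> real) \<Rightarrow> (real \<Rightarrow> real) \<Rightarrow> bool" where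
  "exp_spline \<theta> f f' \<longleftrightarrow> (\<forall>p::int. \<exists>g g'. exp_space \<theta> g g' \<and>
     (\<forall>x\<in>{of_int p..of_int p + 1}. f x = g x \<and> f' x = g' x))"

lemma exp_space_zero: "exp_space \<theta> (\<lambda>x. 0) (\<lambda>x. 0)"
  by (rule exp_spaceI[where A = 0 and B = 0 and C = 0 and D = 0]) simp_all

lemma exp_spline_phi:
  assumes "0 \<le> \<theta>" "\<theta> \<le> pi"
  shows "exp_spline \<theta> (phi1 \<theta>) (dphi1 \<theta>)" "exp_spline \<theta> (phi2 \<theta>) (dphi2 \<theta>)"
proof -
  note W = exp_space_value_shape[OF assms] exp_space_slope_shape[OF assms]
  have out: "\<bar>x\<bar> \<ge> 1" if "p \<noteq> 0" "p \<noteq> -1" "x \<in> {of_int p..of_int p + 1}" for p :: int and x :: real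
  proof (cases "p \<ge> 1")
    case True
    then have "real_of_int p \<ge> 1" by simp
    with that show ?thesis by auto
  next
    case False
    with that have "p + 1 \<le> -1" by linarith
    then have "real_of_int (p + 1) \<le> -1" by linarith
    with that show ?thesis by auto
  qed
  show "exp_spline \<theta> (phi1 \<theta>) (dphi1 \<theta>)"
    unfolding exp_spline_def
  proof
    fix p :: int
    consider "p = 0" | "p = -1" | "p \<noteq> 0" "p \<noteq> -1" by blast
    then show "\<exists>g g'. exp_space \<theta> g g' \<and>
     (\<forall>x\<in>{of_int p..of_int p + 1}. phi1 \<theta> x = g x \<and> dphi1 \<theta> x = g' x)"
    proof cases
      case 1
      then show ?thesis using W(1) phi_unit_interval[OF assms] by auto
    next
      case 2
      then show ?thesis
        using exp_space_reflect[OF W(1), of 0] phi_neg_unit_interval[OF assms]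
        by (intro exI conjI) auto
    next
      case 3
      then show ?thesis
        using exp_space_zero[of \<theta>] phi_outside[OF assms] out by blast
    qed
  qed
  show "exp_spline \<theta> (phi2 \<theta>) (dphi2 \<theta>)"
    unfolding exp_spline_def
  proof
    fix p :: int
    consider "p = 0" | "p = -1" | "p \<noteq> 0" "p \<noteq> -1" by blast
    then show "\<exists>g g'. exp_space \<theta> g g' \<and>
     (\<forall>x\<in>{of_int p..of_int p + 1}. phi2 \<theta> x = g x \<and> dphi2 \<theta> x = g' x)"
    proof cases
      case 1
      then show ?thesis using W(2) phi_unit_interval[OF assms] by auto
    next
      case 2
      then show ?thesis
        using exp_space_lincomb[OF exp_space_zero exp_space_reflect[OF W(2), of 0], of 1 "-1"]
          phi_neg_unit_interval[OF assms]
        by (intro exI conjI) auto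
    next
      case 3
      then show ?thesis
        using exp_space_zero[of \<theta>] phi_outside[OF assms] out by blast
    qed
  qed
qed

text \<open>The two-scale relation. On the cell \<open>[k / m, (k + 1) / m]\<close> the spline is a single element of
  the space, because the cell does not cross an integer; rescaled to \<open>[0, 1]\<close> it has parameter
  \<open>\<theta> / m\<close> and is its own Hermite interpolant. A derivative at scale \<open>1 / m\<close> picks up the
  factor \<open>1 / m\<close>.\<close>

lemma exp_spline_refine:
  fixes m k :: int
  assumes "exp_spline \<theta> f f'" and \<theta>: "0 \<le> \<theta>" "\<theta> \<le> pi" and m: "m \<ge> 1"
    and x: "of_int k \<le> of_int m * x" "of_int m * x \<le> of_int k + 1"
  shows "f x = (\<Sum>i\<in>{k, k + 1}. f (of_int i / of_int m) * phi1 (\<theta> / of_int m) (of_int m * x - of_int i)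
             + f' (of_int i / of_int m) / of_int m * phi2 (\<theta> / of_int m) (of_int m * x - of_int i))"
proof -
  define M \<tau> where "M = real_of_int m" and "\<tau> = \<theta> / M"
  have M: "M \<ge> 1" using m by (simp add: M_def)
  have \<tau>: "0 \<le> \<tau>" "\<tau> \<le> pi"
    using \<theta> M by (auto simp: \<tau>_def field_simps intro: order_trans[OF _ mult_right_mono[of 1]])
  define p where "p = k div m"
  have "k = p * m + k mod m" "0 \<le> k mod m" "k mod m < m"
    using m by (simp_all add: p_def)
  then have "p * m \<le> k" "k + 1 \<le> (p + 1) * m"
    unfolding distrib_right by linarith+
  then have "real_of_int (p * m) \<le> of_int k" "of_int (k + 1) \<le> real_of_int ((p + 1) * m)"
    by (simp_all only: of_int_le_iff)
  then have pk: "of_int p \<le> of_int k / M" "(of_int k + 1) / M \<le> of_int p + 1"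
    using M by (simp_all add: M_def field_simps)
  \<comment> \<open>the piece of the spline on the integer interval that contains the cell\<close>
  obtain g g' where g: "exp_space \<theta> g g'"
    and fg: "\<And>x. x \<in> {of_int p..of_int p + 1} \<Longrightarrow> f x = g x \<and> f' x = g' x"
    using assms(1) unfolding exp_spline_def by meson
  define y where "y = M * x - of_int k"
  have y: "0 \<le> y" "y \<le> 1" using x by (auto simp: y_def M_def)
  have mono: "of_int k / M \<le> (y + of_int k) / M" "(y + of_int k) / M \<le> (of_int k + 1) / M"
    "of_int k / M \<le> (of_int k + 1) / M"
    using y M by (auto intro!: divide_right_mono)
  have xy: "x = 1 / M * y + of_int k / M"
    using M by (simp add: y_def field_simps)
  have kk: "(of_int k + 1) / M = 1 / M * 1 + of_int k / M" by (simp add: add_divide_distrib)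
  define G G' where "G = (\<lambda>y. g (1 / M * y + of_int k / M))"
    and "G' = (\<lambda>y. 1 / M * g' (1 / M * y + of_int k / M))"
  have "exp_space (1 / M * \<theta>) G G'"
    unfolding G_def G'_def using M by (intro exp_space_affine g) auto
  then have "exp_space \<tau> G G'" by (simp add: \<tau>_def)
  from hermite_interpolation[OF this \<tau>, of y]
  have "G y = G 0 * value_shape \<tau> y + G' 0 * slope_shape \<tau> y + G 1 * value_shape \<tau> (1 - y) - G' 1 * slope_shape \<tau> (1 - y)" .
  moreover have "value_shape \<tau> y = phi1 \<tau> y" "slope_shape \<tau> y = phi2 \<tau> y"
    using phi_unit_interval[OF \<tau> y] by simp_all
  moreover have "value_shape \<tau> (1 - y) = phi1 \<tau> (y - 1)" "slope_shape \<tau> (1 - y) = - phi2 \<tau> (y - 1)"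
    using phi_neg_unit_interval[OF \<tau>, of "y - 1"] y by simp_all
  moreover have "G y = f x"
    unfolding G_def xy[symmetric] using fg[of x] mono pk by (simp add: xy add_divide_distrib)
  moreover have "G 0 = f (of_int k / M)" "G' 0 = f' (of_int k / M) / M"
    unfolding G_def G'_def using fg[of "of_int k / M"] mono pk by auto
  moreover have "G 1 = f ((of_int k + 1) / M)" "G' 1 = f' ((of_int k + 1) / M) / M"
    unfolding G_def G'_def kk[symmetric] using fg[of "(of_int k + 1) / M"] mono pk by auto
  ultimately show ?thesis
    by (simp add: y_def M_def \<tau>_def algebra_simps)
qed


section \<open>Hermite splines and their refinement\<close>

definition hermite_spline :: "real \<Rightarrow> (int \<Rightarrow> 'a) \<Rightarrow> (int \<Rightarrow> 'a) \<Rightarrow> real \<Rightarrow> 'a::real_normed_field" where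
  "hermite_spline \<theta> u v x = (\<Sum>\<^sub>\<infinity>n\<in>UNIV. u n * of_real (phi1 \<theta> (x - of_int n))
                                 + v n * of_real (phi2 \<theta> (x - of_int n)))"

definition hermite_spline' :: "real \<Rightarrow> (int \<Rightarrow> 'a) \<Rightarrow> (int \<Rightarrow> 'a) \<Rightarrow> real \<Rightarrow> 'a::real_normed_field" where
  "hermite_spline' \<theta> u v x = (\<Sum>\<^sub>\<infinity>n\<in>UNIV. u n * of_real (dphi1 \<theta> (x - of_int n))
                                  + v n * of_real (dphi2 \<theta> (x - of_int n)))"

lemma infsum_eq_sum:
  fixes f :: "'b \<Rightarrow> 'a::{comm_monoid_add, t2_space}"
  assumes "finite F" "\<And>n. n \<notin> F \<Longrightarrow> f n = 0"
  shows "infsum f UNIV = sum f F"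
proof -
  have "infsum f UNIV = infsum f F"
    using assms(2) by (intro infsum_cong_neutral) auto
  then show ?thesis using assms(1) by simp
qed

lemma hermite_spline_eq_sum:
  assumes "0 \<le> \<theta>" "\<theta> \<le> pi" "finite F" "\<And>n. n \<notin> F \<Longrightarrow> \<bar>x - of_int n\<bar> \<ge> 1"
  shows "hermite_spline \<theta> u v x = (\<Sum>n\<in>F. u n * of_real (phi1 \<theta> (x - of_int n))
                                 + v n * of_real (phi2 \<theta> (x - of_int n)))"
    and "hermite_spline' \<theta> u v x = (\<Sum>n\<in>F. u n * of_real (dphi1 \<theta> (x - of_int n))
                                 + v n * of_real (dphi2 \<theta> (x - of_int n)))"
  unfolding hermite_spline_def hermite_spline'_def
  using phi_outside[OF assms(1,2) assms(4)]
  by (intro infsum_eq_sum assms(3); simp)+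

lemma abs_diff_int_ge_one:
  fixes N n :: int and x :: real
  assumes "of_int N \<le> x" "x \<le> of_int N + 1" "n \<notin> {N, N + 1}"
  shows "\<bar>x - of_int n\<bar> \<ge> 1"
proof -
  have "n \<le> N - 1 \<or> n \<ge> N + 2" using assms(3) by auto
  then have "real_of_int n \<le> of_int (N - 1) \<or> real_of_int n \<ge> of_int (N + 2)"
    by (simp only: of_int_le_iff)
  then show ?thesis using assms(1,2) by auto
qed

lemma hermite_spline_at_int:
  assumes "0 \<le> \<theta>" "\<theta> \<le> pi"
  shows "hermite_spline \<theta> u v (of_int n) = u n" "hermite_spline' \<theta> u v (of_int n) = v n"
proof -
  have *: "\<bar>of_int n - real_of_int l\<bar> \<ge> 1" if "l \<notin> {n}" for l
  proof -
    have "1 \<le> \<bar>n - l\<bar>" using that by auto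
    then have "real_of_int 1 \<le> of_int \<bar>n - l\<bar>" by (simp only: of_int_le_iff)
    then show ?thesis by simp
  qed
  show "hermite_spline \<theta> u v (of_int n) = u n" "hermite_spline' \<theta> u v (of_int n) = v n"
    by (subst hermite_spline_eq_sum[where F = "{n}"]; use * assms in \<open>simp add: phi_zero\<close>)+
qed

text \<open>Near \<open>x\<close> the series is a fixed finite sum: only indices at distance less than \<open>1\<close> from the
  argument contribute, and for arguments around \<open>x\<close> these lie between \<open>\<lfloor>x\<rfloor> - 1\<close> and
  \<open>\<lfloor>x\<rfloor> + 1\<close>.\<close>

lemma hermite_spline_has_derivative:
  assumes "0 \<le> \<theta>" "\<theta> \<le> pi"
  shows "(hermite_spline \<theta> u v has_vector_derivative hermite_spline' \<theta> u v x) (at x)"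
proof -
  define N where "N = \<lfloor>x\<rfloor>"
  have N: "of_int N \<le> x" "x < of_int N + 1" by (simp_all add: N_def)
  define S where "S = {of_int N - 1<..<real_of_int N + 1}"
  have S: "open S" "x \<in> S" using N by (auto simp: S_def)
  have out: "\<bar>y - of_int n\<bar> \<ge> 1" if "y \<in> S" "n \<notin> {N - 1..N + 1}" for y n
  proof -
    have "n \<le> N - 2 \<or> n \<ge> N + 2" using that(2) by auto
    then have "real_of_int n \<le> of_int (N - 2) \<or> real_of_int n \<ge> of_int (N + 2)"
      by (simp only: of_int_le_iff)
    then show ?thesis using that(1) by (auto simp: S_def)
  qed
  have d: "((\<lambda>y. c * of_real (f (y - of_int n))) has_vector_derivative
              c * of_real (f' (x - of_int n))) (at x)"
    if "\<And>z. (f has_real_derivative f' z) (at z)" for f f' :: "real \<Rightarrow> real" and n :: int and c :: 'a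
  proof -
    have "((\<lambda>y. f (y - of_int n)) has_real_derivative f' (x - of_int n)) (at x)"
      using DERIV_shift[of f "f' (x - of_int n)" x "- of_int n"] that by simp
    then show ?thesis
      by (intro has_vector_derivative_mult_right has_vector_derivative_of_real)
        (simp add: has_real_derivative_iff_has_vector_derivative)
  qed
  have "((\<lambda>y. \<Sum>n\<in>{N - 1..N + 1}. u n * of_real (phi1 \<theta> (y - of_int n))
                                 + v n * of_real (phi2 \<theta> (y - of_int n)))
          has_vector_derivative (\<Sum>n\<in>{N - 1..N + 1}. u n * of_real (dphi1 \<theta> (x - of_int n))
                                 + v n * of_real (dphi2 \<theta> (x - of_int n)))) (at x)"
    by (intro has_vector_derivative_sum has_vector_derivative_add d
         phi1_has_derivative phi2_has_derivative assms)
  also have "(\<Sum>n\<in>{N - 1..N + 1}. u n * of_real (dphi1 \<theta> (x - of_int n))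
                                 + v n * of_real (dphi2 \<theta> (x - of_int n))) = hermite_spline' \<theta> u v x"
    by (rule hermite_spline_eq_sum(2)[symmetric]) (use assms out S in auto)
  finally show ?thesis
  proof (rule has_vector_derivative_transform_within_open[OF _ S])
    show "(\<Sum>n\<in>{N - 1..N + 1}. u n * of_real (phi1 \<theta> (y - of_int n))
                                 + v n * of_real (phi2 \<theta> (y - of_int n))) = hermite_spline \<theta> u v y"
      if "y \<in> S" for y
      by (rule hermite_spline_eq_sum(1)[symmetric]) (use assms out that in auto)
  qed
qed

lemma divide_mem_0_pi:
  fixes m \<theta> :: real
  assumes "0 \<le> \<theta>" "\<theta> \<le> pi" "m \<ge> 1"
  shows "0 \<le> \<theta> / m" "\<theta> / m \<le> pi"
proof -
  have "\<theta> / m \<le> \<theta> / 1" using assms by (intro divide_left_mono) auto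
  then show "0 \<le> \<theta> / m" "\<theta> / m \<le> pi" using assms by auto
qed

text \<open>Apply the two-scale relation to every shifted generator and exchange the two finite sums. A
  shift by the integer \<open>l\<close> moves the fine grid by \<open>m l\<close> indices, so that all
  shifted generators are expanded over the same two fine grid points \<open>k\<close> and \<open>k + 1\<close>.\<close>

lemma hermite_spline_refine:
  fixes m :: int and u v :: "int \<Rightarrow> 'a::real_normed_field"
  assumes \<theta>: "0 \<le> \<theta>" "\<theta> \<le> pi" and m: "m \<ge> 1"
  shows "hermite_spline \<theta> u v x = hermite_spline (\<theta> / of_int m) (\<lambda>n. hermite_spline \<theta> u v (of_int n / of_int m))
           (\<lambda>n. hermite_spline' \<theta> u v (of_int n / of_int m) / of_int m) (of_int m * x)"
proof -
  define M \<tau> where "M = real_of_int m" and "\<tau> = \<theta> / M"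
  have M: "M \<ge> 1" using m by (simp add: M_def)
  have \<tau>: "0 \<le> \<tau>" "\<tau> \<le> pi" unfolding \<tau>_def using divide_mem_0_pi[OF \<theta> M] by auto
  define N k where "N = \<lfloor>x\<rfloor>" and "k = \<lfloor>M * x\<rfloor>"
  have N: "of_int N \<le> x" "x \<le> of_int N + 1" unfolding N_def by linarith+
  have k: "of_int k \<le> M * x" "M * x \<le> of_int k + 1" unfolding k_def by linarith+
  have "M * of_int N \<le> M * x" using N M by (intro mult_left_mono) auto
  then have "m * N \<le> k" by (simp add: k_def le_floor_iff M_def)
  moreover have "M * x < M * (of_int N + 1)"
    unfolding N_def using M by (intro mult_strict_left_mono) linarith+
  then have "k + 1 \<le> m * (N + 1)" unfolding k_def M_def by (simp add: floor_less_iff zless_add1_eq add1_zle_eq)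
  \<comment> \<open>both fine grid points lie in the coarse cell of \<open>x\<close>, so one finite index set serves them all\<close>
  ultimately have grid: "of_int N \<le> of_int n / M" "of_int n / M \<le> of_int N + 1" if "n \<in> {k, k + 1}" for n
  proof -
    have "m * N \<le> n" "n \<le> m * (N + 1)" using \<open>m * N \<le> k\<close> \<open>k + 1 \<le> m * (N + 1)\<close> that by auto
    then have "real_of_int (m * N) \<le> of_int n" "of_int n \<le> real_of_int (m * (N + 1))"
      by (simp_all only: of_int_le_iff)
    then show "of_int N \<le> of_int n / M" "of_int n / M \<le> of_int N + 1"
      using M by (simp_all add: M_def field_simps)
  qed
  have two_scale: "f (x - of_int l) = (\<Sum>n\<in>{k, k + 1}. f (of_int n / M - of_int l) * phi1 \<tau> (M * x - of_int n)
       + f' (of_int n / M - of_int l) / M * phi2 \<tau> (M * x - of_int n))"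
    if "exp_spline \<theta> f f'" for f f' and l
  proof -
    have "f (x - of_int l) = (\<Sum>i\<in>{k - m * l, k - m * l + 1}. f (of_int i / M) * phi1 \<tau> (M * (x - of_int l) - of_int i)
       + f' (of_int i / M) / M * phi2 \<tau> (M * (x - of_int l) - of_int i))"
      unfolding M_def \<tau>_def
      by (rule exp_spline_refine[OF that \<theta> m]) (use k in \<open>simp_all add: M_def algebra_simps\<close>)
    also have "\<dots> = (\<Sum>n\<in>{k, k + 1}. f (of_int (n - m * l) / M) * phi1 \<tau> (M * (x - of_int l) - of_int (n - m * l))
       + f' (of_int (n - m * l) / M) / M * phi2 \<tau> (M * (x - of_int l) - of_int (n - m * l)))"
      by (simp add: algebra_simps)
    also have "\<dots> = (\<Sum>n\<in>{k, k + 1}. f (of_int n / M - of_int l) * phi1 \<tau> (M * x - of_int n)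
       + f' (of_int n / M - of_int l) / M * phi2 \<tau> (M * x - of_int n))"
    proof -
      have "M * (x - of_int l) - of_int (n - m * l) = M * x - of_int n"
        "of_int (n - m * l) / M = of_int n / M - of_int l" for n
        using M by (simp_all add: M_def field_simps)
      then show ?thesis by (simp only:)
    qed
    finally show ?thesis .
  qed
  note two_scale1 = two_scale[OF exp_spline_phi(1)[OF \<theta>]]
    and two_scale2 = two_scale[OF exp_spline_phi(2)[OF \<theta>]]
  define F where "F = {N, N + 1}"
  have F: "finite F" by (simp add: F_def)
  have at_x: "hermite_spline \<theta> u v y = (\<Sum>l\<in>F. u l * of_real (phi1 \<theta> (y - of_int l))
                                 + v l * of_real (phi2 \<theta> (y - of_int l)))"
    "hermite_spline' \<theta> u v y = (\<Sum>l\<in>F. u l * of_real (dphi1 \<theta> (y - of_int l))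
                                 + v l * of_real (dphi2 \<theta> (y - of_int l)))"
    if "of_int N \<le> y" "y \<le> of_int N + 1" for y
    by (rule hermite_spline_eq_sum; use F \<theta> abs_diff_int_ge_one[OF that] in \<open>auto simp: F_def\<close>)+
  define P Q :: "int \<Rightarrow> 'a" where "P = (\<lambda>n. of_real (phi1 \<tau> (M * x - of_int n)))"
    and "Q = (\<lambda>n. of_real (phi2 \<tau> (M * x - of_int n)))"
  have "hermite_spline \<theta> u v x = (\<Sum>l\<in>F. \<Sum>n\<in>{k, k + 1}.
      u l * (of_real (phi1 \<theta> (of_int n / M - of_int l)) * P n
              + of_real (dphi1 \<theta> (of_int n / M - of_int l)) / of_real M * Q n)
      + v l * (of_real (phi2 \<theta> (of_int n / M - of_int l)) * P n
              + of_real (dphi2 \<theta> (of_int n / M - of_int l)) / of_real M * Q n))"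
    unfolding at_x(1)[OF N] two_scale1 two_scale2 P_def Q_def
    by (simp only: of_real_sum of_real_add of_real_mult of_real_divide sum_distrib_left)
      (simp only: sum.distrib[symmetric])
  also have "\<dots> = (\<Sum>n\<in>{k, k + 1}. \<Sum>l\<in>F.
      (u l * of_real (phi1 \<theta> (of_int n / M - of_int l))
         + v l * of_real (phi2 \<theta> (of_int n / M - of_int l))) * P n
      + (u l * of_real (dphi1 \<theta> (of_int n / M - of_int l))
         + v l * of_real (dphi2 \<theta> (of_int n / M - of_int l))) / of_real M * Q n)"
    by (subst sum.swap) (intro sum.cong refl, simp add: algebra_simps add_divide_distrib)
  also have "\<dots> = (\<Sum>n\<in>{k, k + 1}. hermite_spline \<theta> u v (of_int n / M) * P n
      + hermite_spline' \<theta> u v (of_int n / M) / of_real M * Q n)"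
    by (intro sum.cong refl)
      (simp only: at_x[OF grid] sum_distrib_right sum_divide_distrib sum.distrib[symmetric])
  also have "\<dots> = hermite_spline \<tau> (\<lambda>n. hermite_spline \<theta> u v (of_int n / M))
           (\<lambda>n. hermite_spline' \<theta> u v (of_int n / M) / of_real M) (M * x)"
    unfolding P_def Q_def
    by (rule hermite_spline_eq_sum(1)[symmetric, OF \<tau>]) (use abs_diff_int_ge_one[OF k] in auto)
  finally show ?thesis by (simp add: M_def \<tau>_def)
qed

section \<open>The subdivision rule samples the spline\<close>

lemma step_size_pos: "m \<ge> 1 \<Longrightarrow> step_size m j > 0"
  by (simp add: step_size_def)

lemma step_size_Suc: "step_size m (Suc j) = step_size m j / of_int m"
  by (simp add: step_size_def)

lemma step_size_mult_mem:
  assumes "0 \<le> \<omega>" "\<omega> \<le> pi" "m \<ge> 1"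
  shows "0 \<le> step_size m j * \<omega>" "step_size m j * \<omega> \<le> pi"
  using divide_mem_0_pi[OF assms(1,2), of "of_int m ^ j"] assms(3)
  by (simp_all add: step_size_def)

lemma hermite_mask_entries:
  assumes "0 \<le> \<omega>" "\<omega> \<le> pi" "m \<ge> 1"
  shows "hermite_mask \<omega> m j n =
    vector [vector [phi1 (step_size m j * \<omega>) (of_int n / of_int m),
                    step_size m j * phi2 (step_size m j * \<omega>) (of_int n / of_int m)],
            vector [1 / step_size m j * dphi1 (step_size m j * \<omega>) (of_int n / of_int m),
                    dphi2 (step_size m j * \<omega>) (of_int n / of_int m)]]"
  unfolding hermite_mask_def Let_def
  using DERIV_imp_deriv[OF phi1_has_derivative[OF step_size_mult_mem[OF assms]]]
    DERIV_imp_deriv[OF phi2_has_derivative[OF step_size_mult_mem[OF assms]]] by simp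

lemma hermite_mask_outside:
  assumes "0 \<le> \<omega>" "\<omega> \<le> pi" "m \<ge> 1" "\<bar>real_of_int n / of_int m\<bar> \<ge> 1"
  shows "hermite_mask \<omega> m j n = 0"
  unfolding hermite_mask_entries[OF assms(1-3)]
  using phi_outside[OF step_size_mult_mem[OF assms(1-3)] assms(4)]
  by (simp add: vec_eq_iff forall_2)

text \<open>One subdivision step evaluates the current spline, in coordinates where its grid is the integers,
  and its derivative at the next finer grid. The powers of \<open>h\<close> in the mask convert between
  derivatives in these coordinates and the derivatives stored in the data.\<close>

lemma mask_sum_component:
  fixes b :: "int \<Rightarrow> 'a::real_normed_field ^ 2" and m n :: int and j :: nat and \<omega> :: real
  assumes "0 \<le> \<omega>" "\<omega> \<le> pi" "m \<ge> 1"
  defines "h \<equiv> step_size m j"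
  defines "c \<equiv> (\<Sum>\<^sub>\<infinity>l\<in>UNIV. map_matrix of_real (hermite_mask \<omega> m j (n - m * l)) *v b l)"
  shows "c $ 1 = hermite_spline (h * \<omega>) (\<lambda>l. b l $ 1) (\<lambda>l. of_real h * b l $ 2) (of_int n / of_int m)"
    and "c $ 2 = hermite_spline' (h * \<omega>) (\<lambda>l. b l $ 1) (\<lambda>l. of_real h * b l $ 2) (of_int n / of_int m)
                   / of_real h"
proof -
  note mem = step_size_mult_mem[OF assms(1-3), of j, folded h_def]
  define x where "x = real_of_int n / of_int m"
  define F where "F = {\<lfloor>x\<rfloor>, \<lfloor>x\<rfloor> + 1}"
  have out: "\<bar>x - of_int l\<bar> \<ge> 1" if "l \<notin> F" for l
    by (rule abs_diff_int_ge_one) (use that in \<open>auto simp: F_def intro: less_imp_le\<close>)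
  have F: "finite F" by (simp add: F_def)
  have x: "of_int (n - m * l) / of_int m = x - of_int l" for l
    using assms(3) by (simp add: x_def field_simps)
  have h: "h > 0" using step_size_pos[OF assms(3)] by (simp add: h_def)
  have c: "c = (\<Sum>l\<in>F. map_matrix of_real (hermite_mask \<omega> m j (n - m * l)) *v b l)"
    unfolding c_def
  proof (rule infsum_eq_sum[OF F])
    fix l assume "l \<notin> F"
    then have "hermite_mask \<omega> m j (n - m * l) = 0"
      using out[OF \<open>l \<notin> F\<close>] by (intro hermite_mask_outside[OF assms(1-3)]) (simp only: x)
    then show "map_matrix of_real (hermite_mask \<omega> m j (n - m * l)) *v b l = 0"
      by (simp add: vec_eq_iff matrix_vector_mult_def)
  qed
  have H: "hermite_mask \<omega> m j (n - m * l) =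
    vector [vector [phi1 (h * \<omega>) (x - of_int l), h * phi2 (h * \<omega>) (x - of_int l)],
            vector [1 / h * dphi1 (h * \<omega>) (x - of_int l), dphi2 (h * \<omega>) (x - of_int l)]]" for l
    unfolding hermite_mask_entries[OF assms(1-3)] x h_def ..
  have sums: "hermite_spline (h * \<omega>) u v x = (\<Sum>l\<in>F. u l * of_real (phi1 (h * \<omega>) (x - of_int l))
                                 + v l * of_real (phi2 (h * \<omega>) (x - of_int l)))"
    "hermite_spline' (h * \<omega>) u v x = (\<Sum>l\<in>F. u l * of_real (dphi1 (h * \<omega>) (x - of_int l))
                                 + v l * of_real (dphi2 (h * \<omega>) (x - of_int l)))" for u v :: "int \<Rightarrow> 'a"
    by (rule hermite_spline_eq_sum[OF mem F]; fact out)+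
  show "c $ 1 = hermite_spline (h * \<omega>) (\<lambda>l. b l $ 1) (\<lambda>l. of_real h * b l $ 2) (of_int n / of_int m)"
    unfolding x_def[symmetric] sums(1)
    unfolding c sum_component
    by (intro sum.cong refl)
      (simp add: matrix_vector_mult_def sum_2 H; simp add: mult_ac)
  show "c $ 2 = hermite_spline' (h * \<omega>) (\<lambda>l. b l $ 1) (\<lambda>l. of_real h * b l $ 2) (of_int n / of_int m)
                   / of_real h"
    unfolding x_def[symmetric] sums(2)
    unfolding c sum_component sum_divide_distrib
    by (intro sum.cong refl)
      (use h in \<open>(simp add: matrix_vector_mult_def sum_2 H; simp add: field_simps)\<close>)
qed

text \<open>The limit function is already present at every level: each step only re-expands the same spline
  on a finer grid, with the parameter scaled accordingly.\<close>

lemma subdivision_spline: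
  fixes a :: "nat \<Rightarrow> int \<Rightarrow> 'a::real_normed_field ^ 2"
  assumes \<omega>: "0 \<le> \<omega>" "\<omega> \<le> pi" and m: "m > 1"
    and rec: "\<And>j n. a (Suc j) n =
           (\<Sum>\<^sub>\<infinity>l\<in>UNIV. map_matrix of_real (hermite_mask \<omega> m j (n - m * l)) *v a j l)"
  shows "hermite_spline \<omega> (\<lambda>n. a 0 n $ 1) (\<lambda>n. a 0 n $ 2) x =
    hermite_spline (step_size m j * \<omega>) (\<lambda>n. a j n $ 1) (\<lambda>n. of_real (step_size m j) * a j n $ 2)
      (of_int m ^ j * x)"
proof (induction j)
  case 0
  show ?case by (simp add: step_size_def)
next
  case (Suc j)
  have m1: "m \<ge> 1" using m by simp
  let ?h = "step_size m j"
  have h: "?h > 0" using step_size_pos[OF m1] .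
  have 1: "hermite_spline (?h * \<omega>) (\<lambda>n. a j n $ 1) (\<lambda>n. of_real ?h * a j n $ 2) (of_int n / of_int m)
      = a (Suc j) n $ 1" for n
    by (simp add: rec mask_sum_component[OF \<omega> m1])
  have 2: "hermite_spline' (?h * \<omega>) (\<lambda>n. a j n $ 1) (\<lambda>n. of_real ?h * a j n $ 2) (of_int n / of_int m)
      / of_int m = of_real (step_size m (Suc j)) * a (Suc j) n $ 2" for n
    using h by (simp add: rec mask_sum_component[OF \<omega> m1] step_size_Suc)
  show ?case
    unfolding Suc hermite_spline_refine[OF step_size_mult_mem[OF \<omega> m1] m1, of j _ _ "of_int m ^ j * x"] 1 2
    by (simp add: step_size_Suc mult.assoc)
qed

section \<open>The dyadic masks\<close>

lemma shapes_at_half: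
  assumes "0 < \<theta>" "\<theta> \<le> pi"
  shows "value_shape \<theta> (1 / 2) = 1 / 2" "slope_shape \<theta> (1 / 2) = tan (\<theta> / 4) / (2 * \<theta>)"
    "value_shape' \<theta> (1 / 2) = - (2 * \<theta> * (sin (\<theta> / 4))\<^sup>2 / sigma_coeff \<theta>)"
    "slope_shape' \<theta> (1 / 2) = (2 * sin (\<theta> / 2) - \<theta>) / (2 * sigma_coeff \<theta>)"
proof -
  define s c where "s = sin (\<theta> / 2)" and "c = cos (\<theta> / 2)"
  have c: "c \<ge> 0" unfolding c_def using assms by (intro cos_ge_zero) auto
  have nz: "\<theta> \<noteq> 0" "sigma_coeff \<theta> \<noteq> 0" "s \<noteq> 0" "1 + c \<noteq> 0"
    using sigma_coeff_pos[of \<theta>] sin_gt_zero[of "\<theta> / 2"] assms c by (auto simp: s_def)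
  have sc: "s\<^sup>2 + c\<^sup>2 = 1" by (simp add: s_def c_def)
  have d: "sin \<theta> = 2 * s * c" "cos \<theta> = c\<^sup>2 - s\<^sup>2"
    unfolding s_def c_def by (rule sin_double_half, rule cos_double_half)
  have sigma: "sigma_coeff \<theta> = 2 * s - \<theta> * c"
    by (simp add: sigma_coeff_def s_def c_def)
  have q: "(sin (\<theta> / 4))\<^sup>2 = (1 - c) / 2" "tan (\<theta> / 4) = s / (1 + c)"
    using cos_double_sin[of "\<theta> / 4"] tan_half[of "\<theta> / 4"] by (simp_all add: c_def s_def add.commute)
  have half: "\<theta> * (1 / 2) = \<theta> / 2" by simp
  note unf = half s_def[symmetric] c_def[symmetric]
  show "value_shape \<theta> (1 / 2) = 1 / 2"
    unfolding value_shape_def unf using nz by (simp add: divide_simps) (simp add: sigma algebra_simps)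
  show "value_shape' \<theta> (1 / 2) = - (2 * \<theta> * (sin (\<theta> / 4))\<^sup>2 / sigma_coeff \<theta>)"
    unfolding value_shape'_def unf q using nz by (simp add: divide_simps) (simp add: algebra_simps)
  define X where "X = (\<theta> * cos \<theta> - sin \<theta>) * (1 - c) / (2 * s) + \<theta> * s * (1 / 2) + (s - \<theta> * c) * s"
  have "X * (1 + c) = s / 2 * sigma_coeff \<theta>"
    unfolding X_def d sigma using nz sc by (simp add: divide_simps) algebra
  then have "X = s / 2 * sigma_coeff \<theta> / (1 + c)"
    by (rule nonzero_eq_divide_eq[OF nz(4), THEN iffD2])
  then show "slope_shape \<theta> (1 / 2) = tan (\<theta> / 4) / (2 * \<theta>)"
    unfolding slope_shape_def unf X_def[symmetric] q using nz by (simp add: mult_ac)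
  have "(\<theta> * cos \<theta> - sin \<theta>) * s / (2 * s) + s + (s - \<theta> * c) * c = (2 * s - \<theta>) / 2"
    unfolding d using nz sc by (simp add: divide_simps) algebra
  then show "slope_shape' \<theta> (1 / 2) = (2 * sin (\<theta> / 2) - \<theta>) / (2 * sigma_coeff \<theta>)"
    unfolding slope_shape'_def unf using nz(1) by (simp only: if_False divide_divide_eq_left)
qed

text \<open>The first generator is even and the second is odd, so negating the index negates exactly the
  off-diagonal entries.\<close>

lemma hermite_mask_dyadic_sign:
  fixes \<epsilon> :: int and j :: nat
  assumes "0 \<le> \<omega>" "\<omega> \<le> pi" "\<epsilon> \<in> {1, -1}"
  defines "h \<equiv> step_size 2 j"
  shows "hermite_mask \<omega> 2 j \<epsilon> =
    vector [vector [value_shape (h * \<omega>) (1 / 2), of_int \<epsilon> * (h * slope_shape (h * \<omega>) (1 / 2))],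
            vector [of_int \<epsilon> * (1 / h * value_shape' (h * \<omega>) (1 / 2)), slope_shape' (h * \<omega>) (1 / 2)]]"
proof -
  note mem = step_size_mult_mem[OF assms(1,2), of 2 j, simplified, folded h_def]
  note p = phi_unit_interval[OF mem, of "1 / 2", simplified]
    and n = phi_neg_unit_interval[OF mem, of "- (1 / 2)", simplified]
  show ?thesis
    using assms(3) unfolding hermite_mask_entries[OF assms(1,2), of 2 j, simplified, folded h_def]
    by (auto simp: p n)
qed

lemma hermite_mask_dyadic:
  assumes "0 < \<omega>" "\<omega> \<le> pi" "\<epsilon> \<in> {1, -1}"
  shows "hermite_mask \<omega> 2 j \<epsilon> = dyadic_mask (\<omega> / 2 ^ j) (step_size 2 j) (of_int \<epsilon>)"
proof -
  have eq: "step_size 2 j * \<omega> = \<omega> / 2 ^ j" by (simp add: step_size_def)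
  have "0 < \<omega> / 2 ^ j" "\<omega> / 2 ^ j \<le> pi"
    using assms divide_mem_0_pi[of \<omega> "2 ^ j"] by auto
  note half = shapes_at_half[OF this]
  have "0 \<le> \<omega>" using assms by simp
  show ?thesis
    unfolding hermite_mask_dyadic_sign[OF \<open>0 \<le> \<omega>\<close> assms(2,3)] eq half dyadic_mask_def
    by (simp add: mult_ac)
qed

lemma dyadic_mask_tendsto:
  assumes "\<epsilon> \<in> {1, -1}"
  shows "((\<lambda>\<theta>. dyadic_mask \<theta> (step_size 2 j) (of_int \<epsilon>)) \<longlongrightarrow> hermite_mask 0 2 j \<epsilon>) (at_right 0)"
proof -
  have l1: "((\<lambda>\<theta>::real. tan (\<theta> / 4) / (2 * \<theta>)) \<longlongrightarrow> 1 / 8) (at_right 0)"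
    by real_asymp
  have l2: "((\<lambda>\<theta>. 2 * \<theta> * (sin (\<theta> / 4))\<^sup>2 / sigma_coeff \<theta>) \<longlongrightarrow> 3 / 2) (at_right 0)"
    unfolding sigma_coeff_def power2_eq_square by real_asymp
  have l3: "((\<lambda>\<theta>. (2 * sin (\<theta> / 2) - \<theta>) / (2 * sigma_coeff \<theta>)) \<longlongrightarrow> - 1 / 4) (at_right 0)"
    unfolding sigma_coeff_def by real_asymp
  have c: "value_shape 0 (1 / 2) = 1 / 2" "slope_shape 0 (1 / 2) = 1 / 8" "value_shape' 0 (1 / 2) = - (3 / 2)" "slope_shape' 0 (1 / 2) = - 1 / 4"
    by (simp_all add: value_shape_def slope_shape_def value_shape'_def slope_shape'_def power2_eq_square)
  define h where "h = step_size 2 j"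
  have H: "hermite_mask 0 2 j \<epsilon> = vector [vector [1 / 2, of_int \<epsilon> * (1 / 8 * h)],
     vector [- of_int \<epsilon> * (3 / 2 * (1 / h)), - 1 / 4]]"
    using hermite_mask_dyadic_sign[OF _ _ assms, of 0 j] by (simp add: h_def c mult.commute)
  show ?thesis
    unfolding dyadic_mask_def H h_def[symmetric]
  proof (intro vec_tendstoI)
    let ?A = "\<lambda>\<theta>. vector [vector [1 / 2, of_int \<epsilon> * (tan (\<theta> / 4) / (2 * \<theta>) * h)],
         vector [- of_int \<epsilon> * (2 * \<theta> * (sin (\<theta> / 4))\<^sup>2 / sigma_coeff \<theta> * (1 / h)),
               (2 * sin (\<theta> / 2) - \<theta>) / (2 * sigma_coeff \<theta>)]] :: real ^ 2 ^ 2"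
    let ?L = "vector [vector [1 / 2, of_int \<epsilon> * (1 / 8 * h)],
     vector [- of_int \<epsilon> * (3 / 2 * (1 / h)), - 1 / 4]] :: real ^ 2 ^ 2"
    fix i k :: 2
    have "((\<lambda>\<theta>. ?A \<theta> $ 1 $ 1) \<longlongrightarrow> ?L $ 1 $ 1) (at_right 0)"
      "((\<lambda>\<theta>. ?A \<theta> $ 1 $ 2) \<longlongrightarrow> ?L $ 1 $ 2) (at_right 0)"
      "((\<lambda>\<theta>. ?A \<theta> $ 2 $ 1) \<longlongrightarrow> ?L $ 2 $ 1) (at_right 0)"
      "((\<lambda>\<theta>. ?A \<theta> $ 2 $ 2) \<longlongrightarrow> ?L $ 2 $ 2) (at_right 0)"
      unfolding vector_2
      by (intro tendsto_const tendsto_mult_left tendsto_mult_right l1 l2 l3)+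
    then show "((\<lambda>\<theta>. ?A \<theta> $ i $ k) \<longlongrightarrow> ?L $ i $ k) (at_right 0)"
      using exhaust_2[of i] exhaust_2[of k] by fastforce
  qed
qed

theorem mainTheorem4:
  fixes \<omega>\<^sub>0 :: real and m :: int
    and a :: "nat \<Rightarrow> int \<Rightarrow> 'a::real_normed_field ^ 2"
    and s :: "real \<Rightarrow> 'a"
  assumes "0 \<le> \<omega>\<^sub>0" and "\<omega>\<^sub>0 \<le> pi" and "m > 1"
    and "(\<lambda>n. (norm (a 0 n))\<^sup>2) summable_on UNIV"
    and "\<And>x. s x = (\<Sum>\<^sub>\<infinity>n\<in>UNIV. a 0 n $ 1 * of_real (phi1 \<omega>\<^sub>0 (x - of_int n))
                                + a 0 n $ 2 * of_real (phi2 \<omega>\<^sub>0 (x - of_int n)))"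
    and "\<And>j n. a (Suc j) n =
           (\<Sum>\<^sub>\<infinity>l\<in>UNIV. map_matrix of_real (hermite_mask \<omega>\<^sub>0 m j (n - m * l)) *v a j l)"
  shows "(\<forall>J n. let x = of_int n / of_int m ^ J in
            s differentiable (at x) \<and> a J n = vector [s x, vector_derivative s (at x)])
       \<and> (m = 2 \<longrightarrow>
           (\<forall>j.
             (\<forall>n. n \<notin> {-1, 0, 1} \<longrightarrow> hermite_mask \<omega>\<^sub>0 m j n = 0)
             \<and> hermite_mask \<omega>\<^sub>0 m j 0 = mat 1
             \<and> (\<forall>\<epsilon>\<in>{1, -1}.
                 (\<omega>\<^sub>0 \<noteq> 0 \<longrightarrow>
                    hermite_mask \<omega>\<^sub>0 m j \<epsilon> = dyadic_mask (\<omega>\<^sub>0 / 2 ^ j) (step_size m j) (of_int \<epsilon>))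
                 \<and> (\<omega>\<^sub>0 = 0 \<longrightarrow>
                    ((\<lambda>\<theta>. dyadic_mask \<theta> (step_size m j) (of_int \<epsilon>)) \<longlongrightarrow> hermite_mask \<omega>\<^sub>0 m j \<epsilon>)
                      (at_right 0)))))"
proof (intro conjI impI allI)
  fix J n
  have m1: "m \<ge> 1" using assms(3) by simp
  note mem = step_size_mult_mem[OF assms(1,2) m1, of J]
  define h where "h = step_size m J"
  define K where "K = real_of_int m ^ J"
  have K: "K > 0" using m1 by (simp add: K_def)
  have h: "h = 1 / K" by (simp add: h_def K_def step_size_def)
  define S where "S = hermite_spline (h * \<omega>\<^sub>0) (\<lambda>n. a J n $ 1) (\<lambda>n. of_real h * a J n $ 2)"
  define D where "D = hermite_spline' (h * \<omega>\<^sub>0) (\<lambda>n. a J n $ 1) (\<lambda>n. of_real h * a J n $ 2)"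
  have s: "s = (\<lambda>x. S (K * x))"
  proof
    fix x
    show "s x = S (K * x)"
      using subdivision_spline[OF assms(1-3) assms(6), of x J]
      by (simp add: assms(5) hermite_spline_def[of \<omega>\<^sub>0] S_def h_def K_def)
  qed
  define x where "x = real_of_int n / of_int m ^ J"
  have Kx: "K * x = of_int n" using K by (simp add: x_def K_def[symmetric])
  have S: "S (of_int n) = a J n $ 1" and D: "D (of_int n) = of_real h * a J n $ 2"
    unfolding S_def D_def by (rule hermite_spline_at_int; use mem in \<open>simp add: h_def\<close>)+
  have "((\<lambda>x. K * x) has_vector_derivative K) (at x)"
    by (auto intro!: derivative_eq_intros)
  moreover have "(S has_vector_derivative D (K * x)) (at (K * x))"
    unfolding S_def D_def h_def by (rule hermite_spline_has_derivative[OF mem])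
  ultimately have "((\<lambda>x. S (K * x)) has_vector_derivative K *\<^sub>R D (K * x)) (at x)"
    using vector_diff_chain_at[of "\<lambda>x. K * x" K x S "D (K * x)"] by (simp add: o_def)
  moreover have "K *\<^sub>R D (K * x) = a J n $ 2"
    using K by (simp add: Kx D h scaleR_conv_of_real)
  ultimately have d: "(s has_vector_derivative a J n $ 2) (at x)"
    by (simp add: s)
  have "a J n = vector [s x, vector_derivative s (at x)]"
    using vector_derivative_at[OF d] by (simp add: vec_eq_iff forall_2 s Kx S)
  with d show "let x = of_int n / of_int m ^ J in
            s differentiable (at x) \<and> a J n = vector [s x, vector_derivative s (at x)]"
    unfolding Let_def x_def[symmetric] using differentiableI_vector by blast
next
  fix j n
  assume m: "m = 2" and n: "n \<notin> {-1, 0, 1::int}"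
  from n have "\<bar>n\<bar> \<ge> 2" by auto
  then have "\<bar>real_of_int n\<bar> \<ge> 2" by linarith
  then show "hermite_mask \<omega>\<^sub>0 m j n = 0"
    using assms m by (intro hermite_mask_outside) auto
next
  fix j
  assume m: "m = 2"
  show "hermite_mask \<omega>\<^sub>0 m j 0 = mat 1"
    using assms(1-3) phi_zero[OF step_size_mult_mem[OF assms(1,2)]]
    by (simp add: hermite_mask_entries vec_eq_iff forall_2 mat_def)
  show "\<forall>\<epsilon>\<in>{1, -1}.
                 (\<omega>\<^sub>0 \<noteq> 0 \<longrightarrow>
                    hermite_mask \<omega>\<^sub>0 m j \<epsilon> = dyadic_mask (\<omega>\<^sub>0 / 2 ^ j) (step_size m j) (of_int \<epsilon>))
                 \<and> (\<omega>\<^sub>0 = 0 \<longrightarrow>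
                    ((\<lambda>\<theta>. dyadic_mask \<theta> (step_size m j) (of_int \<epsilon>)) \<longlongrightarrow> hermite_mask \<omega>\<^sub>0 m j \<epsilon>)
                      (at_right 0))"
    unfolding m using hermite_mask_dyadic[of \<omega>\<^sub>0] dyadic_mask_tendsto assms(1,2) by auto
qed

end
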